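(* Let $\Gamma$ be a group and let $F$ be a $\Gamma$-species with $\Gamma$-cycle index series $Z^{\Gamma}_{F}$. Fix a vector $\pi=\langle \pi_1,\dots,\pi_k\rangle$ of positive integers with $\pi_1+\dots+\pi_k=n$, and let $\gamma\in\Gamma$. Then the number of partially-labeled $F$-structures of profile $\pi$ which are fixed by the action of $\gamma$ is equal to the coefficient of $x_\pi=x_1^{\pi_1}x_2^{\pi_2}\cdots x_k^{\pi_k}$ in $\eta\bigl(Z^{\Gamma}_{F}(\gamma)\bigr)$.
   Context: A (combinatorial) species $F$ assigns to each finite set $A$ a finite set $F[A]$ ("$F$-structures labeled by $A$") and to each bijection $\sigma:A\to B$ a bijection $F[\sigma]:F[A]\to F[B]$, functorially ($F[\mathrm{id}]=\mathrm{id}$, $F[\tau\circ\sigma]=F[\tau]\circ F[\sigma]$). A $\Gamma$-species is a species $F$ together with, for each $\gamma\in\Gamma$ and each finite set $A$, a permutation $\gamma_A$ of $F[A]$, such that $\gamma\mapsto\gamma_A$ is a group action of $\Gamma$ on $F[A]$ and $\gamma_B\circ F[\sigma]=F[\sigma]\circ\gamma_A$ for every bijection $\sigma:A\to B$. Write $[n]=\{1,\dots,n\}$ and $\mathfrak S_n$ for the symmetric group on $[n]$. Let $\Lambda$ be the ring of symmetric functions with power-sum basis $p_1,p_2,\dots$; for $\sigma\in\mathfrak S_n$ put $p_\sigma=p_1^{\sigma_1}p_2^{\sigma_2}\cdots$ where $\sigma_i$ is the number of $i$-cycles of $\sigma$. The $\Gamma$-cycle index series of $F$ assigns to each $\gamma\in\Gamma$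 the series $Z^{\Gamma}_{F}(\gamma)=\sum_{n\ge0}\frac{1}{n!}\sum_{\sigma\in\mathfrak S_n}\mathrm{fix}\bigl(\gamma_{[n]}\cdot F[\sigma]\bigr)\,p_\sigma$, where $\mathrm{fix}(\gamma_{[n]}\cdot F[\sigma])$ is the number of $T\in F[[n]]$ with $\gamma_{[n]}(F[\sigma](T))=T$. Let $\eta$ be the map sending each symmetric function to its expansion as a formal power series in the variables $x_1,x_2,\dots$ (so $\eta(p_i)=\sum_j x_j^i$). Partially-labeled structures: a coloring is a map $c:[n]\to\{1,2,3,\dots\}$; $\mathfrak S_n$ acts on colorings by $(\sigma\cdot c)(i)=c(\sigma^{-1}(i))$ and on $F[[n]]\times\{\text{colorings}\}$ diagonally (via $F[\sigma]$ on the first factor). For the profile $\pi$, let $c_\pi$ be the coloring sending the first $\pi_1$ elements of $[n]$ to $1$, the next $\pi_2$ to $2$, and so on. A partially-labeled $F$-structure of profile $\pi$ is an $\mathfrak S_n$-orbit of a pair $(T,c_\pi)$ with $T\in F[[n]]$. The element $\gamma$ acts on such pairs by $(T,c)\mapsto(\gamma_{[n]}(T),c)$; this commutes with the $\mathfrak S_n$-action and so acts on partially-labeled structures, and "fixed by $\gamma$" refers to this induced action on orbits. *)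

theory Defs
  imports
    Complex_Main
    "HOL-Library.Poly_Mapping"
    "HOL-Combinatorics.Orbits"
    "HOL-Algebra.Group_Action"
    "HOL-Algebra.Sym_Groups"
begin

section \<open>Formal power series in countably many variables\<close>

text \<open>
  A monomial is its finitely supported exponent vector. Variables carry arbitrary natural
  indices here; everything below uses the indices \<open>1, 2, 3, \<dots>\<close> only.
\<close>

typedef 'a mfps = "UNIV :: ((nat \<Rightarrow>\<^sub>0 nat) \<Rightarrow> 'a) set"
  morphisms mfps_coeff Abs_mfps
  by simp

setup_lifting type_definition_mfps

lemma mfps_eqI: "(\<And>m. mfps_coeff f m = mfps_coeff g m) \<Longrightarrow> f = g"
  by transfer auto

lemma finite_monomial_le:
  fixes m :: "nat \<Rightarrow>\<^sub>0 nat"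
  shows "finite {a. \<forall>i. Poly_Mapping.lookup a i \<le> Poly_Mapping.lookup m i}"
proof -
  let ?N = "Max (insert 0 (Poly_Mapping.lookup m ` Poly_Mapping.keys m))"
  have "Poly_Mapping.lookup ` {a. \<forall>i. Poly_Mapping.lookup a i \<le> Poly_Mapping.lookup m i} \<subseteq>
      {f. \<forall>x. (x \<in> Poly_Mapping.keys m \<longrightarrow> f x \<in> {..?N}) \<and> (x \<notin> Poly_Mapping.keys m \<longrightarrow> f x = 0)}"
  proof (clarsimp, intro conjI impI)
    fix a :: "nat \<Rightarrow>\<^sub>0 nat" and x
    assume *: "\<forall>i. Poly_Mapping.lookup a i \<le> Poly_Mapping.lookup m i"
    show "Poly_Mapping.lookup a x \<le> ?N" if "x \<in> Poly_Mapping.keys m"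
      using * that by (intro order_trans[OF spec[OF *]] Max_ge) auto
    show "Poly_Mapping.lookup a x = 0" if "x \<notin> Poly_Mapping.keys m"
      using * that by (metis in_keys_iff le_zero_eq)
  qed
  moreover have "finite {f. \<forall>x. (x \<in> Poly_Mapping.keys m \<longrightarrow> f x \<in> {..?N}) \<and> (x \<notin> Poly_Mapping.keys m \<longrightarrow> f x = (0::nat))}"
    by (intro finite_set_of_finite_funs) auto
  ultimately have "finite (Poly_Mapping.lookup ` {a. \<forall>i. Poly_Mapping.lookup a i \<le> Poly_Mapping.lookup m i})"
    by (rule finite_subset)
  then show ?thesis
    by (rule finite_imageD) (simp add: inj_on_def lookup_inject)
qed

lemma finite_monomial_splits:
  fixes m :: "nat \<Rightarrow>\<^sub>0 nat"
  shows "finite {(a, b). a + b = m}"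
proof (rule finite_subset)
  show "{(a, b). a + b = m} \<subseteq> {a. \<forall>i. Poly_Mapping.lookup a i \<le> Poly_Mapping.lookup m i} \<times> {a. \<forall>i. Poly_Mapping.lookup a i \<le> Poly_Mapping.lookup m i}"
    by (auto simp: lookup_add)
qed (simp add: finite_monomial_le)

lift_definition mfps_const :: "'a::zero \<Rightarrow> 'a mfps"
  is "\<lambda>c m. if m = 0 then c else 0" .

lift_definition mfps_X :: "nat \<Rightarrow> 'a::zero_neq_one mfps"
  is "\<lambda>i m. if m = Poly_Mapping.single i 1 then 1 else 0" .

instantiation mfps :: (comm_semiring_1) comm_semiring_1
begin

lift_definition zero_mfps :: "'a mfps" is "\<lambda>m. 0" .

lift_definition one_mfps :: "'a mfps" is "\<lambda>m. if m = 0 then 1 else 0" .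

lift_definition plus_mfps :: "'a mfps \<Rightarrow> 'a mfps \<Rightarrow> 'a mfps" is "\<lambda>f g m. f m + g m" .

lift_definition times_mfps :: "'a mfps \<Rightarrow> 'a mfps \<Rightarrow> 'a mfps"
  is "\<lambda>f g m. \<Sum>(a, b) | a + b = m. f a * g b" .

instance
proof
  fix f g h :: "'a mfps"
  show "f + g + h = f + (g + h)" by transfer (simp add: add.assoc)
  show "f + g = g + f" by transfer (simp add: add.commute)
  show "0 + f = f" by transfer simp
  show "0 * f = 0" by transfer simp
  show "f * 0 = 0" by transfer simp
  show "(0::'a mfps) \<noteq> 1" by transfer (simp add: fun_eq_iff exI[of _ 0])
  show "(f + g) * h = f * h + g * h"
    by transfer (simp add: distrib_right sum.distrib case_prod_unfold)
  show "f * g = g * f"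
  proof transfer
    fix f g :: "(nat \<Rightarrow>\<^sub>0 nat) \<Rightarrow> 'a"
    show "(\<lambda>m. \<Sum>(a, b) | a + b = m. f a * g b) = (\<lambda>m. \<Sum>(a, b) | a + b = m. g a * f b)"
      by (rule ext, rule sum.reindex_bij_witness[where i = prod.swap and j = prod.swap])
         (simp_all add: case_prod_unfold add.commute mult.commute)
  qed
  show "1 * f = f"
  proof transfer
    fix f :: "(nat \<Rightarrow>\<^sub>0 nat) \<Rightarrow> 'a"
    have "(\<Sum>(a, b) | a + b = m. (if a = 0 then 1 else 0) * f b) = f m" for m
    proof -
      have "(\<Sum>(a, b) | a + b = m. (if a = 0 then 1 else 0) * f b) =
          (\<Sum>(a, b) \<in> {(0 :: nat \<Rightarrow>\<^sub>0 nat, m)}. (if a = 0 then 1 else 0) * f b)"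
        by (rule sum.mono_neutral_right) (auto simp: finite_monomial_splits split: if_splits)
      then show ?thesis by simp
    qed
    then show "(\<lambda>m. \<Sum>(a, b) | a + b = m. (if a = 0 then 1 else 0) * f b) = f" by auto
  qed
  show "f * g * h = f * (g * h)"
  proof transfer
    fix f g h :: "(nat \<Rightarrow>\<^sub>0 nat) \<Rightarrow> 'a"
    have "(\<Sum>(u, c) | u + c = m. (\<Sum>(a, b) | a + b = u. f a * g b) * h c) =
        (\<Sum>(a, v) | a + v = m. f a * (\<Sum>(b, c) | b + c = v. g b * h c))" for m
    proof -
      let ?S = "\<lambda>m::nat \<Rightarrow>\<^sub>0 nat. {(a, b). a + b = m}"
      have "(\<Sum>(u, c)\<in>?S m. (\<Sum>(a, b)\<in>?S u. f a * g b) * h c) =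
          (\<Sum>p\<in>?S m. \<Sum>q\<in>?S (fst p). f (fst q) * g (snd q) * h (snd p))"
        by (simp add: sum_distrib_right case_prod_unfold)
      also have "\<dots> = (\<Sum>(p, q) \<in> (SIGMA p:?S m. ?S (fst p)). f (fst q) * g (snd q) * h (snd p))"
        by (intro sum.Sigma) (simp_all add: finite_monomial_splits)
      also have "\<dots> = (\<Sum>(p, q) \<in> (SIGMA p:?S m. ?S (snd p)). f (fst p) * (g (fst q) * h (snd q)))"
        by (rule sum.reindex_bij_witness[where
              i = "\<lambda>(p, q). ((fst p + fst q, snd q), (fst p, fst q))" and
              j = "\<lambda>(p, q). ((fst q, snd q + snd p), (snd q, snd p))"])
           (auto simp: add.assoc mult.assoc)
      also have "\<dots> = (\<Sum>p\<in>?S m. \<Sum>q\<in>?S (snd p). f (fst p) * (g (fst q) * h (snd q)))"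
        by (intro sum.Sigma[symmetric]) (simp_all add: finite_monomial_splits)
      also have "\<dots> = (\<Sum>(a, v)\<in>?S m. f a * (\<Sum>(b, c)\<in>?S v. g b * h c))"
        by (simp add: sum_distrib_left case_prod_unfold)
      finally show ?thesis .
    qed
    then show "(\<lambda>m. \<Sum>(u, c) | u + c = m. (\<Sum>(a, b) | a + b = u. f a * g b) * h c) =
        (\<lambda>m. \<Sum>(a, v) | a + v = m. f a * (\<Sum>(b, c) | b + c = v. g b * h c))"
      by blast
  qed
qed

end

instantiation mfps :: (comm_ring_1) comm_ring_1
begin

lift_definition uminus_mfps :: "'a mfps \<Rightarrow> 'a mfps" is "\<lambda>f m. - f m" .

lift_definition minus_mfps :: "'a mfps \<Rightarrow> 'a mfps \<Rightarrow> 'a mfps" is "\<lambda>f g m. f m - g m" .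

instance
  by standard (transfer, simp add: fun_eq_iff)+

end

lemma mfps_coeff_zero [simp]: "mfps_coeff 0 m = 0"
  by (simp add: zero_mfps.rep_eq)

lemma mfps_coeff_one: "mfps_coeff 1 m = (if m = 0 then 1 else 0)"
  by (simp add: one_mfps.rep_eq)

lemma mfps_coeff_add [simp]: "mfps_coeff (f + g) m = mfps_coeff f m + mfps_coeff g m"
  by (simp add: plus_mfps.rep_eq)

lemma mfps_coeff_mult:
  "mfps_coeff (f * g) m = (\<Sum>(a, b) | a + b = m. mfps_coeff f a * mfps_coeff g b)"
  by (simp add: times_mfps.rep_eq)

lemma mfps_coeff_sum: "mfps_coeff (\<Sum>x\<in>A. f x) m = (\<Sum>x\<in>A. mfps_coeff (f x) m)"
  by (induction A rule: infinite_finite_induct) auto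

lemma mfps_coeff_const_mult [simp]: "mfps_coeff (mfps_const c * f) m = c * mfps_coeff f m"
proof -
  have "mfps_coeff (mfps_const c * f) m =
      (\<Sum>(a, b) | a + b = m. (if a = 0 then c else 0) * mfps_coeff f b)"
    by (simp add: mfps_coeff_mult mfps_const.rep_eq)
  also have "\<dots> = (\<Sum>(a, b) \<in> {(0 :: nat \<Rightarrow>\<^sub>0 nat, m)}. (if a = 0 then c else 0) * mfps_coeff f b)"
    by (rule sum.mono_neutral_right) (auto simp: finite_monomial_splits split: if_splits)
  finally show ?thesis by simp
qed

text \<open>
  The sum of a possibly infinite family, taken coefficientwise. It is meaningful for families
  in which each coefficient is nonzero for finitely many members only; this is shown for the two
  uses below in \<open>cycle_index_locally_finite\<close> and \<open>eta_locally_finite\<close>.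
\<close>

lift_definition mfps_Sum :: "('i \<Rightarrow> 'a::comm_monoid_add mfps) \<Rightarrow> 'a mfps"
  is "\<lambda>f m. Sum_any (\<lambda>i. f i m)" .

section \<open>Symmetric functions in the power-sum basis\<close>

text \<open>
  A (possibly infinite) rational combination of products of the \<open>p\<^sub>i\<close> is represented as the element
  of \<open>rat mfps\<close> in which the variable of index \<open>i\<close> stands for \<open>p\<^sub>i\<close>. Then \<open>eta\<close> substitutes
  \<open>x\<^sub>1\<^sup>i + x\<^sub>2\<^sup>i + \<dots>\<close> for \<open>p\<^sub>i\<close>. There is no \<open>p\<^sub>0\<close>, so index \<open>0\<close> is given the value \<open>0\<close>.
\<close>

lift_definition power_sum :: "nat \<Rightarrow> rat mfps"
  is "\<lambda>i m. if 0 < i \<and> (\<exists>j>0. m = Poly_Mapping.single j i) then 1 else 0" .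

definition eta :: "rat mfps \<Rightarrow> rat mfps" where
  "eta f = mfps_Sum (\<lambda>q. mfps_const (mfps_coeff f q) * (\<Prod>i\<in>Poly_Mapping.keys q. power_sum i ^ Poly_Mapping.lookup q i))"

definition num_cycles :: "nat \<Rightarrow> (nat \<Rightarrow> nat) \<Rightarrow> nat \<Rightarrow> nat" where
  "num_cycles n \<sigma> i = card {C \<in> Orbits.orbit \<sigma> ` {1..n}. card C = i}"

definition p_perm :: "nat \<Rightarrow> (nat \<Rightarrow> nat) \<Rightarrow> rat mfps" where
  "p_perm n \<sigma> = (\<Prod>i = 1..n. mfps_X i ^ num_cycles n \<sigma> i)"

section \<open>Species with a group action\<close>

text \<open>
  Label sets are the finite sets of natural numbers. A bijection \<open>\<sigma> : A \<rightarrow> B\<close> is given by its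
  restriction to \<open>A\<close>, which determines \<open>B\<close>; \<open>transport F A \<sigma>\<close> is \<open>F[\<sigma>]\<close>.
\<close>

record 's species =
  structures :: "nat set \<Rightarrow> 's set"
  transport :: "nat set \<Rightarrow> (nat \<Rightarrow> nat) \<Rightarrow> 's \<Rightarrow> 's"

record ('g, 's) gspecies = "'s species" +
  gact :: "nat set \<Rightarrow> 'g \<Rightarrow> 's \<Rightarrow> 's"

locale species =
  fixes F :: "('s, 'x) species_scheme"
  assumes finite_structures: "finite A \<Longrightarrow> finite (structures F A)"
    and transport_bij:
      "finite A \<Longrightarrow> bij_betw \<sigma> A B \<Longrightarrow> bij_betw (transport F A \<sigma>) (structures F A) (structures F B)"
    and transport_cong:
      "finite A \<Longrightarrow> bij_betw \<sigma> A B \<Longrightarrow> (\<And>a. a \<in> A \<Longrightarrow> \<sigma> a = \<tau> a) \<Longrightarrow> T \<in> structures F A \<Longrightarrow>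
        transport F A \<sigma> T = transport F A \<tau> T"
    and transport_id:
      "finite A \<Longrightarrow> T \<in> structures F A \<Longrightarrow> transport F A id T = T"
    and transport_comp:
      "finite A \<Longrightarrow> bij_betw \<sigma> A B \<Longrightarrow> bij_betw \<tau> B C \<Longrightarrow> T \<in> structures F A \<Longrightarrow>
        transport F A (\<tau> \<circ> \<sigma>) T = transport F B \<tau> (transport F A \<sigma> T)"

locale gamma_species = species F + group G
  for G :: "('g, 'm) monoid_scheme" (structure)
    and F :: "('g, 's, 'x) gspecies_scheme" +
  assumes gact_action: "finite A \<Longrightarrow> group_action G (structures F A) (gact F A)"
    and gact_transport:
      "finite A \<Longrightarrow> bij_betw \<sigma> A B \<Longrightarrow> \<gamma> \<in> carrier G \<Longrightarrow> T \<in> structures F A \<Longrightarrow>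
        gact F B \<gamma> (transport F A \<sigma> T) = transport F A \<sigma> (gact F A \<gamma> T)"

definition fix_count :: "('g, 's, 'x) gspecies_scheme \<Rightarrow> 'g \<Rightarrow> nat \<Rightarrow> (nat \<Rightarrow> nat) \<Rightarrow> nat" where
  "fix_count F \<gamma> n \<sigma> =
    card {T \<in> structures F {1..n}. gact F {1..n} \<gamma> (transport F {1..n} \<sigma> T) = T}"

definition cycle_index_term :: "('g, 's, 'x) gspecies_scheme \<Rightarrow> 'g \<Rightarrow> nat \<Rightarrow> rat mfps" where
  "cycle_index_term F \<gamma> n =
    mfps_const (1 / fact n) *
      (\<Sum>\<sigma>\<in>carrier (sym_group n). mfps_const (of_nat (fix_count F \<gamma> n \<sigma>)) * p_perm n \<sigma>)"

definition cycle_index :: "('g, 's, 'x) gspecies_scheme \<Rightarrow> 'g \<Rightarrow> rat mfps" where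
  "cycle_index F \<gamma> = mfps_Sum (cycle_index_term F \<gamma>)"

section \<open>Partially-labeled structures\<close>

definition colorings :: "nat \<Rightarrow> (nat \<Rightarrow> nat) set" where
  "colorings n = {1..n} \<rightarrow>\<^sub>E {1..}"

definition pair_action ::
    "('s, 'x) species_scheme \<Rightarrow> nat \<Rightarrow> (nat \<Rightarrow> nat) \<Rightarrow> 's \<times> (nat \<Rightarrow> nat) \<Rightarrow> 's \<times> (nat \<Rightarrow> nat)" where
  "pair_action F n \<sigma> =
    (\<lambda>(T, c) \<in> structures F {1..n} \<times> colorings n.
      (transport F {1..n} \<sigma> T, \<lambda>i\<in>{1..n}. c (inv' \<sigma> i)))"

definition profile_coloring :: "nat list \<Rightarrow> nat \<Rightarrow> nat" where
  "profile_coloring \<pi> = (\<lambda>i\<in>{1..sum_list \<pi>}. LEAST j. i \<le> sum_list (take j \<pi>))"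

definition partially_labeled ::
    "('s, 'x) species_scheme \<Rightarrow> nat list \<Rightarrow> ('s \<times> (nat \<Rightarrow> nat)) set set" where
  "partially_labeled F \<pi> =
    {Group_Action.orbit (sym_group (sum_list \<pi>)) (pair_action F (sum_list \<pi>)) (T, profile_coloring \<pi>) | T.
      T \<in> structures F {1..sum_list \<pi>}}"

definition gact_pair ::
    "('g, 's, 'x) gspecies_scheme \<Rightarrow> nat \<Rightarrow> 'g \<Rightarrow> 's \<times> (nat \<Rightarrow> nat) \<Rightarrow> 's \<times> (nat \<Rightarrow> nat)" where
  "gact_pair F n \<gamma> = (\<lambda>(T, c). (gact F {1..n} \<gamma> T, c))"

definition profile_monomial :: "nat list \<Rightarrow> nat \<Rightarrow>\<^sub>0 nat" where
  "profile_monomial \<pi> = (\<Sum>j<length \<pi>. Poly_Mapping.single (Suc j) (\<pi> ! j))"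

section \<open>Well-definedness\<close>

definition mdeg :: "(nat \<Rightarrow> nat) \<Rightarrow> (nat \<Rightarrow>\<^sub>0 nat) \<Rightarrow> nat" where
  "mdeg w m = (\<Sum>i\<in>Poly_Mapping.keys m. w i * Poly_Mapping.lookup m i)"

definition homogeneous :: "(nat \<Rightarrow> nat) \<Rightarrow> nat \<Rightarrow> 'a::zero mfps \<Rightarrow> bool" where
  "homogeneous w d f \<longleftrightarrow> (\<forall>m. mfps_coeff f m \<noteq> 0 \<longrightarrow> mdeg w m = d)"

lemma mdeg_superset: "finite K \<Longrightarrow> Poly_Mapping.keys m \<subseteq> K \<Longrightarrow> mdeg w m = (\<Sum>i\<in>K. w i * Poly_Mapping.lookup m i)"
  unfolding mdeg_def by (intro sum.mono_neutral_left) (auto simp: in_keys_iff)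

lemma mdeg_zero [simp]: "mdeg w 0 = 0"
  by (simp add: mdeg_def)

lemma mdeg_single [simp]: "mdeg w (Poly_Mapping.single i k) = w i * k"
  by (simp add: mdeg_def)

lemma mdeg_add: "mdeg w (a + b) = mdeg w a + mdeg w b"
proof -
  let ?K = "Poly_Mapping.keys a \<union> Poly_Mapping.keys b"
  have "mdeg w (a + b) = (\<Sum>i\<in>?K. w i * Poly_Mapping.lookup (a + b) i)"
    by (rule mdeg_superset) (simp_all add: keys_add)
  also have "\<dots> = (\<Sum>i\<in>?K. w i * Poly_Mapping.lookup a i) + (\<Sum>i\<in>?K. w i * Poly_Mapping.lookup b i)"
    by (simp add: lookup_add distrib_left sum.distrib)
  also have "\<dots> = mdeg w a + mdeg w b"
    by (simp add: mdeg_superset[of ?K])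
  finally show ?thesis .
qed

lemma homogeneous_one: "homogeneous w 0 (1 :: 'a::comm_semiring_1 mfps)"
  by (auto simp: homogeneous_def mfps_coeff_one)

lemma homogeneous_mult:
  fixes f g :: "'a::comm_semiring_1 mfps"
  assumes "homogeneous w d f" "homogeneous w e g"
  shows "homogeneous w (d + e) (f * g)"
  unfolding homogeneous_def
proof (intro allI impI)
  fix m assume "mfps_coeff (f * g) m \<noteq> 0"
  then obtain a b where ab: "a + b = m" and nz: "mfps_coeff f a * mfps_coeff g b \<noteq> 0"
    unfolding mfps_coeff_mult by (auto elim: sum.not_neutral_contains_not_neutral)
  from nz have "mfps_coeff f a \<noteq> 0" "mfps_coeff g b \<noteq> 0" by auto
  then show "mdeg w m = d + e"
    using assms ab[symmetric] by (simp add: homogeneous_def mdeg_add)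
qed

lemma homogeneous_power:
  fixes f :: "'a::comm_semiring_1 mfps"
  assumes "homogeneous w d f"
  shows "homogeneous w (d * k) (f ^ k)"
  by (induction k) (simp_all add: homogeneous_one homogeneous_mult assms)

lemma homogeneous_prod:
  fixes f :: "'i \<Rightarrow> 'a::comm_semiring_1 mfps"
  assumes "\<And>i. i \<in> A \<Longrightarrow> homogeneous w (d i) (f i)"
  shows "homogeneous w (\<Sum>i\<in>A. d i) (\<Prod>i\<in>A. f i)"
  using assms
  by (induction A rule: infinite_finite_induct) (simp_all add: homogeneous_one homogeneous_mult)

lemma homogeneous_power_sum: "homogeneous (\<lambda>_. 1) i (power_sum i)"
  by (auto simp: homogeneous_def power_sum.rep_eq split: if_splits)

lemma homogeneous_mfps_X: "homogeneous id i (mfps_X i)"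
  by (auto simp: homogeneous_def mfps_X.rep_eq split: if_splits)

lemma finite_monomials_mdeg_id: "finite {q. 0 \<notin> Poly_Mapping.keys q \<and> mdeg id q = d}"
proof -
  have "Poly_Mapping.lookup ` {q. 0 \<notin> Poly_Mapping.keys q \<and> mdeg id q = d} \<subseteq>
      {f. \<forall>x. (x \<in> {..d} \<longrightarrow> f x \<in> {..d}) \<and> (x \<notin> {..d} \<longrightarrow> f x = 0)}"
  proof clarsimp
    fix q :: "nat \<Rightarrow>\<^sub>0 nat" and x
    assume 0: "0 \<notin> Poly_Mapping.keys q"
    have *: "x * Poly_Mapping.lookup q x \<le> mdeg id q" if "x \<in> Poly_Mapping.keys q"
      unfolding mdeg_def using member_le_sum[OF that, of "\<lambda>i. id i * Poly_Mapping.lookup q i"] by simp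
    show "(x \<le> mdeg id q \<longrightarrow> Poly_Mapping.lookup q x \<le> mdeg id q) \<and> (\<not> x \<le> mdeg id q \<longrightarrow> Poly_Mapping.lookup q x = 0)"
    proof (cases "x \<in> Poly_Mapping.keys q")
      case True
      then have "1 \<le> x" "1 \<le> Poly_Mapping.lookup q x"
        using 0 by (auto simp: in_keys_iff Suc_le_eq intro: gr0I)
      then have "x \<le> x * Poly_Mapping.lookup q x" "Poly_Mapping.lookup q x \<le> x * Poly_Mapping.lookup q x" by auto
      then show ?thesis using *[OF True] by linarith
    qed (simp add: in_keys_iff)
  qed
  moreover have "finite {f. \<forall>x. (x \<in> {..d} \<longrightarrow> f x \<in> {..d}) \<and> (x \<notin> {..d} \<longrightarrow> f x = (0::nat))}"
    by (intro finite_set_of_finite_funs) auto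
  ultimately have "finite (Poly_Mapping.lookup ` {q. 0 \<notin> Poly_Mapping.keys q \<and> mdeg id q = d})"
    by (rule finite_subset)
  then show ?thesis
    by (rule finite_imageD) (simp add: inj_on_def lookup_inject)
qed

lemma eta_locally_finite:
  "finite {q. mfps_coeff (mfps_const (mfps_coeff f q) * (\<Prod>i\<in>Poly_Mapping.keys q. power_sum i ^ Poly_Mapping.lookup q i)) m \<noteq> 0}"
proof (rule finite_subset[OF _ finite_monomials_mdeg_id[of "mdeg (\<lambda>_. 1) m"]], clarify)
  fix q
  assume "mfps_coeff (mfps_const (mfps_coeff f q) * (\<Prod>i\<in>Poly_Mapping.keys q. power_sum i ^ Poly_Mapping.lookup q i)) m \<noteq> 0"
  then have nz: "mfps_coeff (\<Prod>i\<in>Poly_Mapping.keys q. power_sum i ^ Poly_Mapping.lookup q i) m \<noteq> 0" by auto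
  have "homogeneous (\<lambda>_. 1) (\<Sum>i\<in>Poly_Mapping.keys q. i * Poly_Mapping.lookup q i) (\<Prod>i\<in>Poly_Mapping.keys q. power_sum i ^ Poly_Mapping.lookup q i)"
    by (intro homogeneous_prod homogeneous_power homogeneous_power_sum)
  then have "mdeg id q = mdeg (\<lambda>_. 1) m"
    using nz by (simp add: homogeneous_def mdeg_def)
  moreover have "0 \<notin> Poly_Mapping.keys q"
  proof
    assume "0 \<in> Poly_Mapping.keys q"
    moreover have "power_sum 0 = 0"
      by (rule mfps_eqI) (simp add: power_sum.rep_eq)
    ultimately have "(\<Prod>i\<in>Poly_Mapping.keys q. power_sum i ^ Poly_Mapping.lookup q i) = 0"
      by (intro prod_zero bexI[of _ 0]) (auto simp: in_keys_iff zero_power)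
    with nz show False by simp
  qed
  ultimately show "0 \<notin> Poly_Mapping.keys q \<and> mdeg id q = mdeg (\<lambda>_. 1) m" by simp
qed

lemma eta_mfps_X: "eta (mfps_X i) = power_sum i"
proof (rule mfps_eqI)
  fix m
  let ?P = "\<lambda>q. mfps_coeff (\<Prod>i\<in>Poly_Mapping.keys q. power_sum i ^ Poly_Mapping.lookup q i) m"
  have "mfps_coeff (eta (mfps_X i)) m = Sum_any (\<lambda>q. mfps_coeff (mfps_X i) q * ?P q)"
    by (simp add: eta_def mfps_Sum.rep_eq)
  also have "\<dots> = Sum_any (\<lambda>q. ?P q when q = Poly_Mapping.single i 1)"
    by (rule arg_cong[where f = Sum_any]) (auto simp: fun_eq_iff mfps_X.rep_eq when_def)
  also have "\<dots> = mfps_coeff (power_sum i) m" by simp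
  finally show "mfps_coeff (eta (mfps_X i)) m = mfps_coeff (power_sum i) m" .
qed

lemma sum_num_cycles:
  assumes "\<sigma> permutes {1..n}"
  shows "(\<Sum>i = 1..n. i * num_cycles n \<sigma> i) = n"
proof -
  let ?O = "Orbits.orbit \<sigma> ` {1..n}"
  have perm: "permutation \<sigma>" using assms permutation_permutes by blast
  have self: "x \<in> Orbits.orbit \<sigma> x" for x by (rule permutation_self_in_orbit[OF perm])
  have sub: "Orbits.orbit \<sigma> x \<subseteq> {1..n}" if "x \<in> {1..n}" for x
    using permutes_orbit_subset[OF assms that] .
  have card: "card C \<in> {1..n}" if "C \<in> ?O" for C
  proof -
    from that obtain x where x: "x \<in> {1..n}" "C = Orbits.orbit \<sigma> x" by auto
    then have "C \<subseteq> {1..n}" "x \<in> C" using sub self by auto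
    then have "card C \<le> n" "card C \<noteq> 0"
      using card_mono[of "{1..n}" C] by (auto simp: finite_subset)
    then show ?thesis by simp
  qed
  have "(\<Sum>i = 1..n. i * num_cycles n \<sigma> i) = (\<Sum>i = 1..n. \<Sum>C | C \<in> ?O \<and> card C = i. card C)"
    by (simp add: num_cycles_def mult.commute)
  also have "\<dots> = (\<Sum>C\<in>?O. card C)"
    using card by (intro sum.group) auto
  also have "\<dots> = card (\<Union>?O)"
  proof (rule card_Union_disjoint[symmetric])
    show "pairwise disjnt ?O"
    proof (rule pairwiseI)
      fix C D assume "C \<in> ?O" "D \<in> ?O" "C \<noteq> D"
      then obtain x y where xy: "C = Orbits.orbit \<sigma> x" "D = Orbits.orbit \<sigma> y" by auto
      show "disjnt C D"
      proof (rule ccontr)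
        assume "\<not> disjnt C D"
        then obtain z where "z \<in> Orbits.orbit \<sigma> x" "z \<in> Orbits.orbit \<sigma> y"
          unfolding xy disjnt_def by auto
        then have "Orbits.orbit \<sigma> x = Orbits.orbit \<sigma> y"
          by (metis orbit_cyclic_eq3 cyclic_on_orbit' perm)
        with \<open>C \<noteq> D\<close> xy show False by simp
      qed
    qed
    show "finite A" if "A \<in> ?O" for A
      using that sub finite_subset by blast
  qed
  also have "\<Union>?O = {1..n}" using sub self by blast
  finally show ?thesis by simp
qed

lemma homogeneous_p_perm:
  assumes "\<sigma> permutes {1..n}"
  shows "homogeneous id n (p_perm n \<sigma>)"
proof -
  have "homogeneous id (\<Sum>i = 1..n. i * num_cycles n \<sigma> i) (p_perm n \<sigma>)"
    unfolding p_perm_def by (intro homogeneous_prod homogeneous_power homogeneous_mfps_X)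
  then show ?thesis by (simp only: sum_num_cycles[OF assms])
qed

lemma cycle_index_locally_finite: "finite {n. mfps_coeff (cycle_index_term F \<gamma> n) q \<noteq> 0}"
proof (rule finite_subset[of _ "{mdeg id q}"], clarify)
  fix n assume "mfps_coeff (cycle_index_term F \<gamma> n) q \<noteq> 0"
  then have "(\<Sum>\<sigma>\<in>carrier (sym_group n). of_nat (fix_count F \<gamma> n \<sigma>) * mfps_coeff (p_perm n \<sigma>) q) \<noteq> 0"
    by (simp add: cycle_index_term_def mfps_coeff_sum)
  then obtain \<sigma> where "\<sigma> permutes {1..n}" "mfps_coeff (p_perm n \<sigma>) q \<noteq> 0"
    by (auto elim!: sum.not_neutral_contains_not_neutral simp: sym_group_carrier)
  then show "n = mdeg id q"
    using homogeneous_p_perm by (auto simp: homogeneous_def)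
qed simp

end

theory Submission
  imports Defs
begin

text \<open>
  The coefficient of \<open>x\<^sub>\<pi>\<close> in \<open>\<eta>(p\<^sub>\<sigma>)\<close> counts the colorings of \<open>[n]\<close> with content \<open>\<pi>\<close> that are constant on
  the cycles of \<open>\<sigma>\<close>. Hence \<open>n!\<close> times the coefficient of \<open>x\<^sub>\<pi>\<close> in \<open>\<eta>(Z(\<gamma>))\<close> is the sum over \<open>\<sigma>\<close> of
  the number of pairs \<open>(T, c)\<close>, with \<open>c\<close> of content \<open>\<pi>\<close>, that are fixed by \<open>\<gamma>\<sigma>\<close>. The permutations act
  transitively on the colorings of content \<open>\<pi>\<close>, so the orbits of these pairs are the
  partially-labeled structures of profile \<open>\<pi>\<close>, and a version of Burnside's lemma twisted by the
  commuting bijection \<open>\<gamma>\<close> counts those which \<open>\<gamma>\<close> fixes.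
\<close>

section \<open>Orbits fixed by a bijection commuting with a group action\<close>

lemma (in group_action) orbit_eq_of_mem:
  assumes "x \<in> E" "y \<in> orbit G \<phi> x"
  shows "orbit G \<phi> y = orbit G \<phi> x"
proof -
  have sub: "orbit G \<phi> z \<subseteq> E" if "z \<in> E" for z
    using that element_image by (auto simp: orbit_def)
  have "y \<in> E" using assms sub by auto
  with assms show ?thesis
    using sub orbit_trans orbit_sym by (meson subset_antisym subset_iff)
qed

text \<open>Left translation by \<open>k\<close> carries the stabilizer of \<open>x\<close> onto
  this set, which is a left coset.\<close>

lemma (in group_action) card_transporter:
  assumes "x \<in> E" "k \<in> carrier G"
  shows "card {h \<in> carrier G. \<phi> h x = \<phi> k x} = card (stabilizer G \<phi> x)"
proof -
  interpret G: group G using group_hom by (rule group_hom.axioms)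
  have "bij_betw (\<lambda>s. k \<otimes> s) (stabilizer G \<phi> x) {h \<in> carrier G. \<phi> h x = \<phi> k x}"
  proof (rule bij_betw_byWitness[where f' = "\<lambda>h. inv k \<otimes> h"])
    show "\<forall>s\<in>stabilizer G \<phi> x. inv k \<otimes> (k \<otimes> s) = s"
      using assms by (simp add: stabilizer_def G.m_assoc[symmetric])
    show "\<forall>h\<in>{h \<in> carrier G. \<phi> h x = \<phi> k x}. k \<otimes> (inv k \<otimes> h) = h"
      using assms by (simp add: G.m_assoc[symmetric])
    show "(\<lambda>s. k \<otimes> s) ` stabilizer G \<phi> x \<subseteq> {h \<in> carrier G. \<phi> h x = \<phi> k x}"
      using assms by (auto simp: stabilizer_def composition_rule)
    show "(\<lambda>h. inv k \<otimes> h) ` {h \<in> carrier G. \<phi> h x = \<phi> k x} \<subseteq> stabilizer G \<phi> x"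
      using assms by (auto simp: stabilizer_def composition_rule intro: orbit_sym_aux)
  qed
  then show ?thesis by (simp add: bij_betw_same_card)
qed

text \<open>
  If \<open>g\<close> fixes the orbit of \<open>x\<close>, the \<open>h\<close> with \<open>g (\<phi> h x) = x\<close> form a coset of the stabilizer of \<open>x\<close>;
  otherwise there are none.
\<close>

lemma (in group_action) twisted_burnside:
  assumes fin: "finite (carrier G)" "finite X" and sub: "X \<subseteq> E"
    and closed: "\<And>h x. h \<in> carrier G \<Longrightarrow> x \<in> X \<Longrightarrow> \<phi> h x \<in> X"
    and bij: "bij_betw g X X"
    and comm: "\<And>h x. h \<in> carrier G \<Longrightarrow> x \<in> X \<Longrightarrow> g (\<phi> h x) = \<phi> h (g x)"
  shows "card {S \<in> orbit G \<phi> ` X. g ` S = S} * order G =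
    (\<Sum>h\<in>carrier G. card {x \<in> X. g (\<phi> h x) = x})"
proof -
  let ?O = "orbit G \<phi>"
  have gX: "g x \<in> X" if "x \<in> X" for x using bij that by (auto simp: bij_betw_def)
  have inj: "inj_on g X" using bij by (simp add: bij_betw_def)
  \<comment> \<open>Since \<open>g\<close> commutes with the action it carries orbits to orbits, so
    it acts on the set of orbits.\<close>
  have img: "g ` ?O x = ?O (g x)" if "x \<in> X" for x
    using that comm by (auto simp: orbit_def intro!: image_eqI)
  have count: "card {h \<in> carrier G. g (\<phi> h x) = x} =
      (if g ` ?O x = ?O x then card (stabilizer G \<phi> x) else 0)" if x: "x \<in> X" for x
  proof (cases "g ` ?O x = ?O x")
    case True
    have "x \<in> g ` ?O x" using True orbit_refl sub x by auto
    then obtain k where k: "k \<in> carrier G" "g (\<phi> k x) = x" by (auto simp: orbit_def)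
    \<comment> \<open>Injectivity of \<open>g\<close> on \<open>X\<close> turns
      \<open>g (\<phi> h x) = g (\<phi> k x)\<close> into equality of the arguments.\<close>
    have "{h \<in> carrier G. g (\<phi> h x) = x} = {h \<in> carrier G. \<phi> h x = \<phi> k x}"
      using k x closed inj by (auto simp: inj_on_def)
    then show ?thesis using True card_transporter k(1) x sub by auto
  next
    case False
    have "g (\<phi> h x) \<noteq> x" if h: "h \<in> carrier G" for h
    proof
      assume "g (\<phi> h x) = x"
      then have "\<phi> h (g x) = x" using comm h x by simp
      then have "x \<in> ?O (g x)" using h unfolding orbit_def by force
      then have "?O x = ?O (g x)" using orbit_eq_of_mem gX sub x by blast
      then show False using False img[OF x] by metis
    qed
    then have "{h \<in> carrier G. g (\<phi> h x) = x} = {}" by blast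
    then show ?thesis using False by (simp only: card.empty if_False)
  qed
  have fibre: "{x \<in> X. ?O x = S} = S" if S: "S \<in> ?O ` X" for S
  proof -
    obtain y where y: "y \<in> X" "S = ?O y" using S by auto
    have "S \<subseteq> X" using y closed by (auto simp: orbit_def)
    moreover have "?O x = S" if "x \<in> S" for x using y sub that orbit_eq_of_mem by auto
    moreover have "x \<in> S" if "x \<in> X" "?O x = S" for x using that sub orbit_refl by auto
    ultimately show ?thesis by blast
  qed
  have "(\<Sum>h\<in>carrier G. card {x \<in> X. g (\<phi> h x) = x}) =
      (\<Sum>h\<in>carrier G. \<Sum>x | x \<in> X \<and> g (\<phi> h x) = x. 1)" by simp
  \<comment> \<open>Double counting of the pairs \<open>(h, x)\<close>: first by group element, now
    by point; afterwards the points are grouped by orbit.\<close>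
  also have "\<dots> = (\<Sum>x\<in>X. \<Sum>h | h \<in> carrier G \<and> g (\<phi> h x) = x. 1)"
    using fin by (rule sum.swap_restrict)
  also have "\<dots> = (\<Sum>x\<in>X. if g ` ?O x = ?O x then card (stabilizer G \<phi> x) else 0)"
    using count by (intro sum.cong) simp_all
  also have "\<dots> = (\<Sum>S\<in>?O ` X. \<Sum>x | x \<in> X \<and> ?O x = S.
      if g ` ?O x = ?O x then card (stabilizer G \<phi> x) else 0)"
    using fin by (intro sum.group[symmetric]) auto
  also have "\<dots> = (\<Sum>S\<in>?O ` X. if g ` S = S then order G else 0)"
  proof (rule sum.cong)
    fix S assume S: "S \<in> ?O ` X"
    have "(\<Sum>x | x \<in> X \<and> ?O x = S. if g ` ?O x = ?O x then card (stabilizer G \<phi> x) else 0) =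
        (\<Sum>x | x \<in> X \<and> ?O x = S. if g ` S = S then card (stabilizer G \<phi> x) else 0)"
      by (rule sum.cong) auto
    also have "\<dots> = (if g ` S = S then \<Sum>x\<in>S. card (stabilizer G \<phi> x) else 0)"
      using fibre[OF S] by simp
    \<comment> \<open>Orbit-stabilizer: the stabilizer sizes along one orbit add up to the group
      order, so every fixed orbit has the same weight.\<close>
    also have "(\<Sum>x\<in>S. card (stabilizer G \<phi> x)) = order G"
      using S sub fin by (intro card_stablizer_sum) (auto simp: orbits_def)
    finally show "(\<Sum>x | x \<in> X \<and> ?O x = S. if g ` ?O x = ?O x then card (stabilizer G \<phi> x) else 0) =
        (if g ` S = S then order G else 0)" .
  qed simp
  also have "\<dots> = card {S \<in> ?O ` X. g ` S = S} * order G"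
    using fin by (simp add: sum.If_cases Int_def)
  finally show ?thesis by simp
qed

section \<open>Coefficients of symmetric functions\<close>

text \<open>Positive weights cannot cancel, so every value \<open>g x\<close> lies in the finite
  support of \<open>m\<close>, although the target \<open>{1..}\<close> is infinite.\<close>

lemma finite_weighted_maps:
  fixes m :: "nat \<Rightarrow>\<^sub>0 nat" and f :: "'i \<Rightarrow> nat"
  assumes "finite I" "\<And>x. x \<in> I \<Longrightarrow> 0 < f x"
  shows "finite {g \<in> I \<rightarrow>\<^sub>E {1..}. (\<Sum>x\<in>I. Poly_Mapping.single (g x) (f x)) = m}"
proof (rule finite_subset)
  show "{g \<in> I \<rightarrow>\<^sub>E {1..}. (\<Sum>x\<in>I. Poly_Mapping.single (g x) (f x)) = m}
      \<subseteq> I \<rightarrow>\<^sub>E Poly_Mapping.keys m"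
  proof safe
    fix g x assume g: "g \<in> I \<rightarrow>\<^sub>E {1..}" and x: "x \<in> I"
    have "f x \<le> Poly_Mapping.lookup (\<Sum>y\<in>I. Poly_Mapping.single (g y) (f y)) (g x)"
      using member_le_sum[OF x, of "\<lambda>y. Poly_Mapping.lookup (Poly_Mapping.single (g y) (f y)) (g x)"]
        assms(1) by (simp add: lookup_sum)
    then show "g x \<in> Poly_Mapping.keys (\<Sum>y\<in>I. Poly_Mapping.single (g y) (f y))"
      using assms(2)[OF x] by (simp add: in_keys_iff)
  qed auto
qed (use assms in \<open>simp add: finite_PiE\<close>)

text \<open>Expanding the product selects one term from each factor \<open>power_sum (f x)\<close>,
  namely a power of the variable with index \<open>g x\<close>; the coefficient counts the
  selections \<open>g\<close> that produce \<open>m\<close>. The induction removes one factor at a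
  time and splits \<open>m\<close> accordingly.\<close>

lemma mfps_coeff_prod_power_sum:
  fixes m :: "nat \<Rightarrow>\<^sub>0 nat" and f :: "'i \<Rightarrow> nat"
  assumes "finite I" "\<And>x. x \<in> I \<Longrightarrow> 0 < f x"
  shows "mfps_coeff (\<Prod>x\<in>I. power_sum (f x)) m =
    of_nat (card {g \<in> I \<rightarrow>\<^sub>E {1..}. (\<Sum>x\<in>I. Poly_Mapping.single (g x) (f x)) = m})"
  using assms
proof (induction I arbitrary: m rule: finite_induct)
  case empty
  have "{g \<in> {} \<rightarrow>\<^sub>E {1..}. (\<Sum>x\<in>{}. Poly_Mapping.single (g x) (f x)) = m} =
      (if m = 0 then {\<lambda>_. undefined} else {} :: ('i \<Rightarrow> nat) set)"
    by auto
  then show ?case by (simp add: mfps_coeff_one)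
next
  case (insert x I)
  let ?w = "\<lambda>I g. \<Sum>y\<in>I. Poly_Mapping.single (g y) (f y)"
  let ?A = "\<lambda>I m. {g \<in> I \<rightarrow>\<^sub>E {1..}. ?w I g = m}"
  let ?S = "{(a, b). a + b = m}"
  let ?h = "\<lambda>g. (Poly_Mapping.single (g x) (f x), ?w I g)"
  have fx: "0 < f x" using insert.prems by simp
  \<comment> \<open>For a splitting \<open>p\<close> of \<open>m\<close>, the product of the two
    coefficients counts the selections whose part at \<open>x\<close> is \<open>fst p\<close> and
    whose part on \<open>I\<close> is \<open>snd p\<close>.\<close>
  have fibre: "mfps_coeff (power_sum (f x)) (fst p) * of_nat (card (?A I (snd p))) =
      of_nat (card {g \<in> ?A (insert x I) m. ?h g = p})" if p: "p \<in> ?S" for p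
  proof (cases "\<exists>j>0. fst p = Poly_Mapping.single j (f x)")
    case True
    then obtain j where j: "0 < j" "fst p = Poly_Mapping.single j (f x)" by auto
    have "bij_betw (\<lambda>g. g(x := j)) (?A I (snd p)) {g \<in> ?A (insert x I) m. ?h g = p}"
    \<comment> \<open>The value at \<open>x\<close> is forced to be \<open>j\<close>, and
      extensional functions are \<open>undefined\<close> off their domain, so setting and erasing
      this value are mutually inverse.\<close>
    proof (rule bij_betw_byWitness[where f' = "\<lambda>g. g(x := undefined)"])
      show "\<forall>g\<in>?A I (snd p). (g(x := j))(x := undefined) = g"
        using insert.hyps by (auto simp: fun_eq_iff PiE_def extensional_def)
      show "\<forall>g\<in>{g \<in> ?A (insert x I) m. ?h g = p}. (g(x := undefined))(x := j) = g"
      proof safe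
        fix g assume "p = ?h g"
        then have "Poly_Mapping.single (g x) (f x) = Poly_Mapping.single j (f x)" using j by simp
        \<comment> \<open>With exponent zero all these monomials would coincide; positivity of
          \<open>f x\<close> lets \<open>j\<close> be read off.\<close>
        then have "g x = j" using fx
          by (metis lookup_single_eq lookup_single_not_eq less_irrefl)
        then show "(g(x := undefined))(x := j) = g" by auto
      qed
      show "(\<lambda>g. g(x := j)) ` ?A I (snd p) \<subseteq> {g \<in> ?A (insert x I) m. ?h g = p}"
      proof (rule image_subsetI)
        fix g assume g: "g \<in> ?A I (snd p)"
        have "g(x := j) \<in> insert x I \<rightarrow>\<^sub>E {1..}"
          using j(1) g by (auto simp: PiE_def extensional_def)
        moreover have w: "?w I (g(x := j)) = ?w I g" using insert.hyps by (intro sum.cong) auto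
        ultimately show "g(x := j) \<in> {g \<in> ?A (insert x I) m. ?h g = p}"
          using insert.hyps p j g by (auto simp del: fun_upd_apply simp: w fun_upd_same)
      qed
      show "(\<lambda>g. g(x := undefined)) ` {g \<in> ?A (insert x I) m. ?h g = p} \<subseteq> ?A I (snd p)"
      proof (rule image_subsetI)
        fix g assume g: "g \<in> {g \<in> ?A (insert x I) m. ?h g = p}"
        have "g(x := undefined) \<in> I \<rightarrow>\<^sub>E {1..}"
          using g insert.hyps by (auto simp: PiE_def extensional_def)
        moreover have "?w I (g(x := undefined)) = ?w I g" using insert.hyps by (intro sum.cong) auto
        ultimately show "g(x := undefined) \<in> ?A I (snd p)" using g by (auto simp del: fun_upd_apply)
      qed
    qed
    then have "card (?A I (snd p)) = card {g \<in> ?A (insert x I) m. ?h g = p}"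
      by (rule bij_betw_same_card)
    then show ?thesis using True fx by (simp add: power_sum.rep_eq)
  next
    case False
    have "{g \<in> ?A (insert x I) m. ?h g = p} = {}"
    proof safe
      fix g assume "g \<in> insert x I \<rightarrow>\<^sub>E {1..}" "p = ?h g"
      then show "g \<in> {}" using False by (auto simp: PiE_iff dest!: spec[of _ "g x"])
    qed
    moreover have "mfps_coeff (power_sum (f x)) (fst p) = 0"
      using False by (auto simp: power_sum.rep_eq)
    ultimately show ?thesis by (simp only: card.empty of_nat_0 mult_zero_left)
  qed
  have "mfps_coeff (\<Prod>y\<in>insert x I. power_sum (f y)) m =
      (\<Sum>p\<in>?S. mfps_coeff (power_sum (f x)) (fst p) * of_nat (card (?A I (snd p))))"
    using insert by (simp add: mfps_coeff_mult case_prod_unfold)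
  also have "\<dots> = (\<Sum>p\<in>?S. of_nat (card {g \<in> ?A (insert x I) m. ?h g = p}))"
    using fibre by (intro sum.cong) auto
  also have "\<dots> = of_nat (\<Sum>p\<in>?S. \<Sum>g | g \<in> ?A (insert x I) m \<and> ?h g = p. 1)"
    by simp
  also have "(\<Sum>p\<in>?S. \<Sum>g | g \<in> ?A (insert x I) m \<and> ?h g = p. 1) = (\<Sum>g\<in>?A (insert x I) m. 1::nat)"
  proof (rule sum.group)
    show "finite (?A (insert x I) m)" using insert by (intro finite_weighted_maps) auto
    show "finite ?S" by (rule finite_monomial_splits)
    show "?h ` ?A (insert x I) m \<subseteq> ?S" using insert.hyps by auto
  qed
  finally show ?case by simp
qed

section \<open>Monomials and the linearity of \<open>eta\<close>\<close>

definition mfps_monom :: "(nat \<Rightarrow>\<^sub>0 nat) \<Rightarrow> 'a::zero_neq_one mfps" where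
  "mfps_monom q = Abs_mfps (\<lambda>m. if m = q then 1 else 0)"

lemma mfps_coeff_monom: "mfps_coeff (mfps_monom q) m = (if m = q then 1 else 0)"
  by (simp add: mfps_monom_def Abs_mfps_inverse)

lemma mfps_monom_0: "mfps_monom 0 = (1 :: 'a::comm_semiring_1 mfps)"
  by (rule mfps_eqI) (simp add: mfps_coeff_monom mfps_coeff_one)

lemma mfps_monom_mult:
  "mfps_monom a * mfps_monom b = (mfps_monom (a + b) :: 'a::comm_semiring_1 mfps)"
proof (rule mfps_eqI)
  fix m
  have "mfps_coeff (mfps_monom a * mfps_monom b :: 'a mfps) m =
      (\<Sum>p | p \<in> {(a, b). a + b = m} \<and> p = (a, b). 1)"
    unfolding mfps_coeff_mult mfps_coeff_monom sum.inter_filter[OF finite_monomial_splits]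
    by (intro sum.cong) (auto split: if_splits)
  also have "{p. p \<in> {(a, b). a + b = m} \<and> p = (a, b)} = (if m = a + b then {(a, b)} else {})"
    by auto
  finally show "mfps_coeff (mfps_monom a * mfps_monom b :: 'a mfps) m =
      mfps_coeff (mfps_monom (a + b)) m"
    by (simp add: mfps_coeff_monom)
qed

lemma mfps_X_power:
  "mfps_X i ^ k = (mfps_monom (Poly_Mapping.single i k) :: 'a::comm_semiring_1 mfps)"
proof (induction k)
  case (Suc k)
  have "mfps_X i = (mfps_monom (Poly_Mapping.single i 1) :: 'a mfps)"
    by (rule mfps_eqI) (simp add: mfps_coeff_monom mfps_X.rep_eq)
  then show ?case using Suc by (simp add: mfps_monom_mult flip: single_add)
qed (simp add: mfps_monom_0)

lemma prod_mfps_monom: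
  "(\<Prod>x\<in>A. mfps_monom (f x)) = (mfps_monom (\<Sum>x\<in>A. f x) :: 'a::comm_semiring_1 mfps)"
  by (induction A rule: infinite_finite_induct) (simp_all add: mfps_monom_0 mfps_monom_mult)

abbreviation power_sum_monomial :: "(nat \<Rightarrow>\<^sub>0 nat) \<Rightarrow> rat mfps" where
  "power_sum_monomial q \<equiv> \<Prod>i\<in>Poly_Mapping.keys q. power_sum i ^ Poly_Mapping.lookup q i"

lemma mfps_coeff_eta:
  "mfps_coeff (eta f) m = Sum_any (\<lambda>q. mfps_coeff f q * mfps_coeff (power_sum_monomial q) m)"
  by (simp add: eta_def mfps_Sum.rep_eq)

text \<open>Finite support gives access to the additive and distributive laws for
  \<open>Sum_any\<close>, and so to linearity of \<open>eta\<close>.\<close>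

lemma finite_eta_support:
  "finite {q. mfps_coeff f q * mfps_coeff (power_sum_monomial q) m \<noteq> 0}"
  using eta_locally_finite[of f m] by simp

lemma eta_add: "eta (f + g) = eta f + eta g"
  by (rule mfps_eqI)
    (simp only: mfps_coeff_eta mfps_coeff_add distrib_right Sum_any.distrib[OF finite_eta_support finite_eta_support])

lemma eta_zero: "eta 0 = 0"
  by (rule mfps_eqI) (simp add: mfps_coeff_eta)

lemma eta_sum: "eta (\<Sum>x\<in>A. f x) = (\<Sum>x\<in>A. eta (f x))"
  by (induction A rule: infinite_finite_induct) (simp_all add: eta_zero eta_add)

lemma eta_const_mult: "eta (mfps_const c * f) = mfps_const c * eta f"
  by (rule mfps_eqI)
    (simp add: mfps_coeff_eta mult.assoc Sum_any_right_distrib[OF finite_eta_support])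

text \<open>Only the summand at \<open>q\<close> survives. Each \<open>p_perm\<close> is a single
  monomial, so this and linearity evaluate \<open>eta\<close> on the terms of the cycle
  index.\<close>

lemma eta_monom: "eta (mfps_monom q) = power_sum_monomial q"
proof (rule mfps_eqI)
  fix m
  have "mfps_coeff (eta (mfps_monom q)) m =
      Sum_any (\<lambda>q'. if q' = q then mfps_coeff (power_sum_monomial q') m else 0)"
    unfolding mfps_coeff_eta by (rule Sum_any.cong) (simp add: mfps_coeff_monom)
  then show "mfps_coeff (eta (mfps_monom q)) m = mfps_coeff (power_sum_monomial q) m"
    by simp
qed

section \<open>The grading with \<open>p\<^sub>i\<close> in degree \<open>i\<close>, and reduction
  to one term of the cycle index\<close>

lemma homogeneous_power_sum_monomial: "homogeneous (\<lambda>_. 1) (mdeg id q) (power_sum_monomial q)"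
proof -
  have "homogeneous (\<lambda>_. 1) (\<Sum>i\<in>Poly_Mapping.keys q. i * Poly_Mapping.lookup q i) (power_sum_monomial q)"
    by (intro homogeneous_prod homogeneous_power homogeneous_power_sum)
  then show ?thesis by (simp add: mdeg_def)
qed

text \<open>Cycle lengths add up to \<open>n\<close>, so each \<open>p_perm n \<sigma>\<close> has
  weight \<open>n\<close>. Hence terms for different \<open>n\<close> share no monomial.\<close>

lemma homogeneous_cycle_index_term: "homogeneous id n (cycle_index_term F \<gamma> n)"
  unfolding homogeneous_def
proof (intro allI impI)
  fix q assume "mfps_coeff (cycle_index_term F \<gamma> n) q \<noteq> 0"
  then have "(\<Sum>\<sigma>\<in>carrier (sym_group n). of_nat (fix_count F \<gamma> n \<sigma>) * mfps_coeff (p_perm n \<sigma>) q) \<noteq> 0"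
    by (simp add: cycle_index_term_def mfps_coeff_sum)
  then obtain \<sigma> where "\<sigma> permutes {1..n}" "mfps_coeff (p_perm n \<sigma>) q \<noteq> 0"
    by (auto elim!: sum.not_neutral_contains_not_neutral simp: sym_group_carrier)
  then show "mdeg id q = n"
    using homogeneous_p_perm by (auto simp: homogeneous_def)
qed

lemma mfps_coeff_cycle_index:
  "mfps_coeff (cycle_index F \<gamma>) q = mfps_coeff (cycle_index_term F \<gamma> (mdeg id q)) q"
proof -
  have "mfps_coeff (cycle_index_term F \<gamma> n) q =
      (if n = mdeg id q then mfps_coeff (cycle_index_term F \<gamma> n) q else 0)" for n
    using homogeneous_cycle_index_term[of n F \<gamma>] by (auto simp: homogeneous_def)
  then have "mfps_coeff (cycle_index F \<gamma>) q =
      Sum_any (\<lambda>n. if n = mdeg id q then mfps_coeff (cycle_index_term F \<gamma> n) q else 0)"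
    unfolding cycle_index_def mfps_Sum.rep_eq by (rule Sum_any.cong)
  then show ?thesis by simp
qed

text \<open>Substituting power sums turns weight into total degree. Only monomials \<open>q\<close>
  whose weight is the degree of \<open>m\<close> contribute, and these can occur in just one term of
  the cycle index.\<close>

lemma mfps_coeff_eta_cycle_index:
  "mfps_coeff (eta (cycle_index F \<gamma>)) m =
    mfps_coeff (eta (cycle_index_term F \<gamma> (mdeg (\<lambda>_. 1) m))) m"
  unfolding mfps_coeff_eta
proof (rule Sum_any.cong)
  fix q
  show "mfps_coeff (cycle_index F \<gamma>) q * mfps_coeff (power_sum_monomial q) m =
      mfps_coeff (cycle_index_term F \<gamma> (mdeg (\<lambda>_. 1) m)) q * mfps_coeff (power_sum_monomial q) m"
    using homogeneous_power_sum_monomial[of q]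
    by (cases "mfps_coeff (power_sum_monomial q) m = 0")
      (auto simp: homogeneous_def mfps_coeff_cycle_index)
qed

lemma eta_p_perm: "eta (p_perm n \<sigma>) = (\<Prod>i = 1..n. power_sum i ^ num_cycles n \<sigma> i)"
proof -
  let ?q = "\<Sum>i = 1..n. Poly_Mapping.single i (num_cycles n \<sigma> i)"
  have look: "Poly_Mapping.lookup ?q i = (if i \<in> {1..n} then num_cycles n \<sigma> i else 0)" for i
    by (simp add: lookup_sum lookup_single when_def)
  have "eta (p_perm n \<sigma>) = power_sum_monomial ?q"
    by (simp add: p_perm_def mfps_X_power prod_mfps_monom eta_monom)
  also have "\<dots> = (\<Prod>i = 1..n. power_sum i ^ Poly_Mapping.lookup ?q i)"
  \<comment> \<open>Lengths outside the support of \<open>?q\<close> are those of no cycle; their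
    factor is a zeroth power, hence \<open>1\<close>.\<close>
  proof (rule prod.mono_neutral_left)
    show "Poly_Mapping.keys ?q \<subseteq> {1..n}"
      by (rule subsetI) (simp only: in_keys_iff look split: if_splits)
  qed (auto simp: in_keys_iff)
  also have "\<dots> = (\<Prod>i = 1..n. power_sum i ^ num_cycles n \<sigma> i)"
    by (rule prod.cong) (simp_all only: look if_True)
  finally show ?thesis .
qed

lemma mfps_coeff_eta_cycle_index_term:
  "mfps_coeff (eta (cycle_index_term F \<gamma> n)) m =
    (\<Sum>\<sigma>\<in>carrier (sym_group n). of_nat (fix_count F \<gamma> n \<sigma>) * mfps_coeff (eta (p_perm n \<sigma>)) m) / fact n"
  by (simp add: cycle_index_term_def eta_const_mult eta_sum mfps_coeff_sum)

section \<open>Colorings and their content\<close>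

text \<open>This is the exponent vector of the product of the variables with indices
  \<open>c 1\<close>, ..., \<open>c n\<close>.\<close>

definition content :: "nat \<Rightarrow> (nat \<Rightarrow> nat) \<Rightarrow> (nat \<Rightarrow>\<^sub>0 nat)" where
  "content n c = (\<Sum>i = 1..n. Poly_Mapping.single (c i) 1)"

lemma lookup_content: "Poly_Mapping.lookup (content n c) j = card {i \<in> {1..n}. c i = j}"
  by (simp add: content_def lookup_sum lookup_single when_def sum.If_cases Int_def)

lemma content_permute:
  assumes "\<sigma> permutes {1..n}"
  shows "content n (\<lambda>i\<in>{1..n}. c (\<sigma> i)) = content n c"
proof -
  have "content n (\<lambda>i\<in>{1..n}. c (\<sigma> i)) = (\<Sum>i = 1..n. Poly_Mapping.single (c (\<sigma> i)) 1)"
    unfolding content_def by (rule sum.cong) auto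
  also have "\<dots> = content n c"
    unfolding content_def using sum.permute[OF assms, of "\<lambda>i. Poly_Mapping.single (c i) (1::nat)"]
    by (simp add: o_def)
  finally show ?thesis .
qed

text \<open>Equal contents give equal multisets of colors. The result is the transitivity of the
  symmetric group on colorings of a given content.\<close>

lemma content_eq_imp_permutes:
  assumes "content n c = content n d"
  obtains \<sigma> where "\<sigma> permutes {1..n}" "\<And>i. i \<in> {1..n} \<Longrightarrow> c i = d (\<sigma> i)"
proof -
  have cnt: "count (image_mset c (mset_set {1..n})) j = Poly_Mapping.lookup (content n c) j" for c :: "nat \<Rightarrow> nat" and j
    by (simp add: lookup_content count_image_mset vimage_def Int_def conj_commute)
  have "image_mset c (mset_set {1..n}) = image_mset d (mset_set {1..n})"
    by (rule multiset_eqI) (simp only: cnt assms)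
  then obtain \<sigma> where "\<sigma> permutes {1..n}" "\<forall>i\<in>{1..n}. c i = d (\<sigma> i)"
    by (rule image_mset_eq_implies_permutes[OF finite_atLeastAtMost])
  then show ?thesis using that by blast
qed

section \<open>Colorings constant on the cycles of a permutation\<close>

lemma sum_single_const: "(\<Sum>i\<in>C. Poly_Mapping.single j 1) = Poly_Mapping.single j (card C)"
  for j :: nat
  by (induction C rule: infinite_finite_induct) (simp_all del: sum_constant flip: single_add)

lemma finite_colorings_content: "finite {c \<in> colorings n. content n c = m}"
  unfolding colorings_def content_def by (rule finite_weighted_maps) auto

lemma card_cycle_in_range:
  assumes "\<sigma> permutes {1..n}" "C \<in> Orbits.orbit \<sigma> ` {1..n}"
  shows "card C \<in> {1..n}"
proof -
  have perm: "permutation \<sigma>" using assms(1) permutation_permutes by blast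
  obtain x where x: "x \<in> {1..n}" "C = Orbits.orbit \<sigma> x" using assms(2) by auto
  then have "C \<subseteq> {1..n}" "x \<in> C"
    using permutes_orbit_subset[OF assms(1)] permutation_self_in_orbit[OF perm] by auto
  then show ?thesis
    using card_mono[of "{1..n}" C] by (auto simp: finite_subset Suc_le_eq card_gt_0_iff)
qed

lemma eta_p_perm_eq_prod_cycles:
  assumes "\<sigma> permutes {1..n}"
  shows "eta (p_perm n \<sigma>) = (\<Prod>C\<in>Orbits.orbit \<sigma> ` {1..n}. power_sum (card C))"
proof -
  let ?O = "Orbits.orbit \<sigma> ` {1..n}"
  have "eta (p_perm n \<sigma>) = (\<Prod>i = 1..n. \<Prod>C | C \<in> ?O \<and> card C = i. power_sum (card C))"
    by (simp add: eta_p_perm num_cycles_def)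
  also have "\<dots> = (\<Prod>C\<in>?O. power_sum (card C))"
    using card_cycle_in_range[OF assms] by (intro prod.group) auto
  finally show ?thesis .
qed

text \<open>An invariant coloring amounts to one color per cycle, and a cycle of size
  \<open>k\<close> contributes the \<open>k\<close>-th power of the variable of its color. These are
  the selections counted when the product of power sums over the cycles is expanded.\<close>

lemma mfps_coeff_eta_p_perm:
  assumes \<sigma>: "\<sigma> permutes {1..n}"
  shows "mfps_coeff (eta (p_perm n \<sigma>)) m =
    of_nat (card {c \<in> colorings n. content n c = m \<and> (\<forall>i\<in>{1..n}. c (\<sigma> i) = c i)})"
proof -
  let ?orb = "Orbits.orbit \<sigma>"
  let ?O = "?orb ` {1..n}"
  let ?A = "{g \<in> ?O \<rightarrow>\<^sub>E {1..}. (\<Sum>C\<in>?O. Poly_Mapping.single (g C) (card C)) = m}"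
  let ?B = "{c \<in> colorings n. content n c = m \<and> (\<forall>i\<in>{1..n}. c (\<sigma> i) = c i)}"
  have perm: "permutation \<sigma>" using \<sigma> permutation_permutes by blast
  have self: "x \<in> ?orb x" for x by (rule permutation_self_in_orbit[OF perm])
  have sub: "?orb x \<subseteq> {1..n}" if "x \<in> {1..n}" for x
    using permutes_orbit_subset[OF \<sigma> that] .
  have orb_eq: "?orb y = ?orb x" if "y \<in> ?orb x" for x y
    using that by (metis orbit_cyclic_eq3 cyclic_on_orbit' perm)
  have fibre: "{i \<in> {1..n}. ?orb i = C} = C" if "C \<in> ?O" for C
    using that sub self orb_eq by blast
  \<comment> \<open>Invariance under one step spreads along the orbit, whose points all stay in
    \<open>{1..n}\<close>.\<close>
  have const: "c y = c x" if "\<forall>i\<in>{1..n}. c (\<sigma> i) = c i" "x \<in> {1..n}" "y \<in> ?orb x"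
    for c :: "nat \<Rightarrow> nat" and x y
    using that(3)
  proof induction
    case base then show ?case using that by simp
  next
    case (step y)
    then have "y \<in> {1..n}" using sub[OF that(2)] by blast
    then show ?case using step.IH that(1) by simp
  qed
  have content: "content n (\<lambda>i\<in>{1..n}. g (?orb i)) = (\<Sum>C\<in>?O. Poly_Mapping.single (g C) (card C))" for g
  proof -
    have "content n (\<lambda>i\<in>{1..n}. g (?orb i)) = (\<Sum>i\<in>{1..n}. Poly_Mapping.single (g (?orb i)) 1)"
      unfolding content_def by (rule sum.cong) auto
    also have "\<dots> = (\<Sum>C\<in>?O. \<Sum>i | i \<in> {1..n} \<and> ?orb i = C. Poly_Mapping.single (g (?orb i)) 1)"
      by (rule sum.group[symmetric]) auto
    also have "\<dots> = (\<Sum>C\<in>?O. \<Sum>i | i \<in> {1..n} \<and> ?orb i = C. Poly_Mapping.single (g C) 1)"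
      by (intro sum.cong) auto
    also have "\<dots> = (\<Sum>C\<in>?O. Poly_Mapping.single (g C) (card C))"
      using fibre by (intro sum.cong) (simp_all only: sum_single_const)
    finally show ?thesis .
  qed
  \<comment> \<open>The color of a cycle is read off at an arbitrary representative; by
    \<open>const\<close> the choice does not matter.\<close>
  have surj: "(\<lambda>i\<in>{1..n}. (\<lambda>C\<in>?O. c (SOME i. i \<in> C)) (?orb i)) = c" if c: "c \<in> ?B" for c
  proof
    fix i
    show "(\<lambda>i\<in>{1..n}. (\<lambda>C\<in>?O. c (SOME i. i \<in> C)) (?orb i)) i = c i"
    proof (cases "i \<in> {1..n}")
      case True
      have "c (SOME k. k \<in> ?orb i) = c i"
        using const[of c i] c True someI[of "\<lambda>k. k \<in> ?orb i", OF self] by blast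
      then show ?thesis using True by auto
    next
      case False then show ?thesis using c by (auto simp: colorings_def PiE_def extensional_def)
    qed
  qed
  have "bij_betw (\<lambda>g. \<lambda>i\<in>{1..n}. g (?orb i)) ?A ?B"
  proof (rule bij_betw_byWitness[where f' = "\<lambda>c. \<lambda>C\<in>?O. c (SOME i. i \<in> C)"])
    show "\<forall>g\<in>?A. (\<lambda>C\<in>?O. (\<lambda>i\<in>{1..n}. g (?orb i)) (SOME i. i \<in> C)) = g"
    proof (intro ballI ext)
      fix g C assume g: "g \<in> ?A"
      show "(\<lambda>C\<in>?O. (\<lambda>i\<in>{1..n}. g (?orb i)) (SOME i. i \<in> C)) C = g C"
      proof (cases "C \<in> ?O")
        case True
        then obtain x where x: "x \<in> {1..n}" "C = ?orb x" by auto
        have "(SOME i. i \<in> C) \<in> C" using self x by (metis someI)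
        then have "(SOME i. i \<in> C) \<in> {1..n}" "?orb (SOME i. i \<in> C) = C"
          using x sub[OF x(1)] orb_eq by blast+
        then show ?thesis using True by simp
      next
        case False then show ?thesis using g by (auto simp: PiE_def extensional_def)
      qed
    qed
    show "\<forall>c\<in>?B. (\<lambda>i\<in>{1..n}. (\<lambda>C\<in>?O. c (SOME i. i \<in> C)) (?orb i)) = c"
      using surj by blast
    show "(\<lambda>g. \<lambda>i\<in>{1..n}. g (?orb i)) ` ?A \<subseteq> ?B"
    proof (rule image_subsetI)
      fix g assume g: "g \<in> ?A"
      have inv: "\<sigma> i \<in> {1..n}" "?orb (\<sigma> i) = ?orb i" if "i \<in> {1..n}" for i
        using that permutes_in_image[OF \<sigma>] orb_eq[OF orbit.base] by auto
      have "(\<lambda>i\<in>{1..n}. g (?orb i)) \<in> colorings n"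
        using g by (auto simp: colorings_def)
      then show "(\<lambda>i\<in>{1..n}. g (?orb i)) \<in> ?B"
        using g inv by (simp add: content del: atLeastAtMost_iff One_nat_def)
    qed
    show "(\<lambda>c. \<lambda>C\<in>?O. c (SOME i. i \<in> C)) ` ?B \<subseteq> ?A"
    proof (rule image_subsetI)
      fix c assume c: "c \<in> ?B"
      let ?g = "\<lambda>C\<in>?O. c (SOME i. i \<in> C)"
      have "?g C \<in> {1..}" if C: "C \<in> ?O" for C
      proof -
        have "(SOME i. i \<in> C) \<in> {1..n}" using C sub self by (metis imageE someI subsetD)
        then show ?thesis using c C by (auto simp: colorings_def)
      qed
      moreover have "(\<Sum>C\<in>?O. Poly_Mapping.single (?g C) (card C)) = m"
        using content[of ?g] surj[OF c] c by simp
      ultimately show "?g \<in> ?A" by auto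
    qed
  qed
  then have "card ?A = card ?B" by (rule bij_betw_same_card)
  moreover have "0 < card C" if "C \<in> ?O" for C
    using card_cycle_in_range[OF \<sigma> that] by simp
  ultimately show ?thesis
    by (simp add: eta_p_perm_eq_prod_cycles[OF \<sigma>] mfps_coeff_prod_power_sum)
qed

text \<open>The partial sums of \<open>\<pi>\<close> are the ends of consecutive blocks of
  positions. The empty partial sum is \<open>0\<close>, so color \<open>Suc j\<close> belongs to the
  list entry at index \<open>j\<close>.\<close>

lemma least_sum_list_take_eq_iff:
  fixes \<pi> :: "nat list"
  assumes "i \<le> sum_list \<pi>"
  shows "(LEAST j. i \<le> sum_list (take j \<pi>)) = Suc j \<longleftrightarrow>
    sum_list (take j \<pi>) < i \<and> i \<le> sum_list (take (Suc j) \<pi>)"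
proof
  have ex: "i \<le> sum_list (take (length \<pi>) \<pi>)" using assms by simp
  assume *: "(LEAST j. i \<le> sum_list (take j \<pi>)) = Suc j"
  then show "sum_list (take j \<pi>) < i \<and> i \<le> sum_list (take (Suc j) \<pi>)"
    using LeastI[of "\<lambda>j. i \<le> sum_list (take j \<pi>)", OF ex]
      not_less_Least[of j "\<lambda>j. i \<le> sum_list (take j \<pi>)"] by auto
next
  have mono: "sum_list (take k \<pi>) \<le> sum_list (take l \<pi>)" if "k \<le> l" for k l
    using that by (metis le_add1 le_add_diff_inverse sum_list_append take_add)
  assume *: "sum_list (take j \<pi>) < i \<and> i \<le> sum_list (take (Suc j) \<pi>)"
  show "(LEAST j. i \<le> sum_list (take j \<pi>)) = Suc j"
  proof (rule Least_equality)
    fix k assume "i \<le> sum_list (take k \<pi>)"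
    then show "Suc j \<le> k" using * mono[of k j] by (meson not_less_eq_eq le_trans not_less)
  qed (use * in simp)
qed

lemma profile_coloring_in_colorings: "profile_coloring \<pi> \<in> colorings (sum_list \<pi>)"
proof -
  \<comment> \<open>The value \<open>0\<close> would put the positive position \<open>i\<close> at
    or below the empty partial sum.\<close>
  have "(LEAST j. i \<le> sum_list (take j \<pi>)) \<noteq> 0" if "i \<in> {1..sum_list \<pi>}" for i
  proof
    assume "(LEAST j. i \<le> sum_list (take j \<pi>)) = 0"
    then have "i \<le> sum_list (take 0 \<pi>)"
      using LeastI[of "\<lambda>j. i \<le> sum_list (take j \<pi>)" "length \<pi>"] that by simp
    then show False using that by simp
  qed
  then show ?thesis
    by (auto simp: colorings_def profile_coloring_def Suc_le_eq simp del: atLeastAtMost_iff)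
qed

lemma lookup_profile_monomial:
  "Poly_Mapping.lookup (profile_monomial \<pi>) (Suc j) = (if j < length \<pi> then \<pi> ! j else 0)"
  "Poly_Mapping.lookup (profile_monomial \<pi>) 0 = 0"
  by (simp_all add: profile_monomial_def lookup_sum lookup_single when_def)

lemma content_profile_coloring: "content (sum_list \<pi>) (profile_coloring \<pi>) = profile_monomial \<pi>"
proof (rule poly_mapping_eqI)
  fix j
  let ?n = "sum_list \<pi>"
  show "Poly_Mapping.lookup (content ?n (profile_coloring \<pi>)) j =
      Poly_Mapping.lookup (profile_monomial \<pi>) j"
  proof (cases j)
    case 0
    have "{i \<in> {1..?n}. profile_coloring \<pi> i = 0} = {}"
      using profile_coloring_in_colorings[of \<pi>] by (force simp: colorings_def PiE_iff)
    then show ?thesis by (simp only: 0 lookup_content lookup_profile_monomial card.empty)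
  next
    case (Suc k)
    have le: "sum_list (take l \<pi>) \<le> ?n" for l
      by (metis append_take_drop_id le_add1 sum_list_append)
    \<comment> \<open>The block has as length the entry at index \<open>k\<close>, and it is empty
      beyond the end of the list.\<close>
    have "{i \<in> {1..?n}. profile_coloring \<pi> i = Suc k} =
        {sum_list (take k \<pi>) <.. sum_list (take (Suc k) \<pi>)}"
      using least_sum_list_take_eq_iff[of _ \<pi> k] le[of "Suc k"]
      by (auto simp: profile_coloring_def)
    then have "Poly_Mapping.lookup (content ?n (profile_coloring \<pi>)) j =
        sum_list (take (Suc k) \<pi>) - sum_list (take k \<pi>)"
      by (simp only: Suc lookup_content card_greaterThanAtMost)
    then show ?thesis
      by (simp add: Suc lookup_profile_monomial take_Suc_conv_app_nth)
  qed
qed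

lemma mdeg_profile_monomial: "mdeg (\<lambda>_. 1) (profile_monomial \<pi>) = sum_list \<pi>"
proof -
  have "mdeg (\<lambda>_. 1) (\<Sum>x\<in>A. f x) = (\<Sum>x\<in>A. mdeg (\<lambda>_. 1) (f x))" for A :: "nat set" and f
    by (induction A rule: infinite_finite_induct) (simp_all add: mdeg_add)
  then show ?thesis by (simp add: profile_monomial_def sum_list_sum_nth atLeast0LessThan)
qed

section \<open>The action on colored structures\<close>

context species
begin

lemma pair_action_closed:
  assumes "\<sigma> permutes {1..n}" "T \<in> structures F {1..n}" "c \<in> colorings n"
  shows "transport F {1..n} \<sigma> T \<in> structures F {1..n}" "(\<lambda>i\<in>{1..n}. c (inv' \<sigma> i)) \<in> colorings n"
proof -
  show "transport F {1..n} \<sigma> T \<in> structures F {1..n}"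
    using transport_bij[of "{1..n}" \<sigma> "{1..n}"] assms(1,2)
    by (metis bij_betwE finite_atLeastAtMost permutes_imp_bij)
  show "(\<lambda>i\<in>{1..n}. c (inv' \<sigma> i)) \<in> colorings n"
    using assms(3) permutes_in_image[OF permutes_inv[OF assms(1)]] by (auto simp: colorings_def)
qed

lemma pair_action_comp:
  assumes "\<sigma> permutes {1..n}" "\<tau> permutes {1..n}" "x \<in> structures F {1..n} \<times> colorings n"
  shows "pair_action F n (\<sigma> \<circ> \<tau>) x = pair_action F n \<sigma> (pair_action F n \<tau> x)"
proof -
  obtain T c where x: "x = (T, c)" "T \<in> structures F {1..n}" "c \<in> colorings n" using assms by auto
  \<comment> \<open>Inversion reverses composition, so precomposing colorings with inverses gives a
    left action.\<close>
  have "inv' (\<sigma> \<circ> \<tau>) = inv' \<tau> \<circ> inv' \<sigma>"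
    using assms permutes_bij o_inv_distrib by blast
  then show ?thesis
    using x pair_action_closed[OF assms(2) x(2,3)] assms(1,2)
      transport_comp[of "{1..n}" \<tau> "{1..n}" \<sigma> "{1..n}" T] permutes_in_image[OF permutes_inv[OF assms(1)]]
    by (auto simp: pair_action_def permutes_imp_bij fun_eq_iff)
qed

lemma group_action_pair_action:
  "group_action (sym_group n) (structures F {1..n} \<times> colorings n) (pair_action F n)"
proof -
  let ?E = "structures F {1..n} \<times> colorings n"
  have id: "pair_action F n id x = x" if "x \<in> ?E" for x
    using that transport_id
    by (auto simp: pair_action_def colorings_def PiE_def extensional_def fun_eq_iff)
  have closed: "pair_action F n \<sigma> x \<in> ?E" if "\<sigma> permutes {1..n}" "x \<in> ?E" for \<sigma> x
    using that pair_action_closed[OF that(1)] by (auto simp: pair_action_def)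
  have bij: "pair_action F n \<sigma> \<in> Bij ?E" if \<sigma>: "\<sigma> permutes {1..n}" for \<sigma>
  proof -
    have "bij_betw (pair_action F n \<sigma>) ?E ?E"
    proof (rule bij_betw_byWitness[where f' = "pair_action F n (inv' \<sigma>)"])
      show "\<forall>x\<in>?E. pair_action F n (inv' \<sigma>) (pair_action F n \<sigma> x) = x"
        using pair_action_comp[OF permutes_inv[OF \<sigma>] \<sigma>, symmetric] id permutes_inv_o[OF \<sigma>] by auto
      show "\<forall>x\<in>?E. pair_action F n \<sigma> (pair_action F n (inv' \<sigma>) x) = x"
        using pair_action_comp[OF \<sigma> permutes_inv[OF \<sigma>], symmetric] id permutes_inv_o[OF \<sigma>] by auto
    qed (use closed \<sigma> permutes_inv[OF \<sigma>] in blast)+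
    then show ?thesis by (simp add: Bij_def pair_action_def)
  qed
  have "pair_action F n \<in> hom (sym_group n) (BijGroup ?E)"
  proof (rule homI)
    fix \<sigma> \<tau> assume "\<sigma> \<in> carrier (sym_group n)" "\<tau> \<in> carrier (sym_group n)"
    then have st: "\<sigma> permutes {1..n}" "\<tau> permutes {1..n}" by (simp_all add: sym_group_carrier)
    \<comment> \<open>Elements of \<open>BijGroup\<close> are functions restricted to the set, so
      the law must also hold off it, where both sides are \<open>undefined\<close>.\<close>
    have "pair_action F n (\<sigma> \<circ> \<tau>) x = compose ?E (pair_action F n \<sigma>) (pair_action F n \<tau>) x" for x
      using pair_action_comp[OF st, of x] by (cases "x \<in> ?E") (auto simp: compose_def pair_action_def)
    then show "pair_action F n (\<sigma> \<otimes>\<^bsub>sym_group n\<^esub> \<tau>) =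
        pair_action F n \<sigma> \<otimes>\<^bsub>BijGroup ?E\<^esub> pair_action F n \<tau>"
      using bij st by (auto simp: BijGroup_def sym_group_mult)
  qed (use bij in \<open>auto simp: BijGroup_def sym_group_carrier\<close>)
  then show ?thesis
    by (intro group_action.intro group_hom.intro group_hom_axioms.intro
        sym_group_is_group group_BijGroup)
qed

text \<open>By transitivity, the orbit of any pair of the right content contains a pair colored by
  \<open>profile_coloring \<pi>\<close>. The orbits thus come from a set closed under the action, as
  the orbit count requires.\<close>

lemma partially_labeled_eq_orbits:
  "partially_labeled F \<pi> =
    Group_Action.orbit (sym_group (sum_list \<pi>)) (pair_action F (sum_list \<pi>)) `
      (structures F {1..sum_list \<pi>} \<times> {c \<in> colorings (sum_list \<pi>). content (sum_list \<pi>) c = profile_monomial \<pi>})"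
    (is "_ = ?orb ` (?S \<times> ?C)")
proof
  show "partially_labeled F \<pi> \<subseteq> ?orb ` (?S \<times> ?C)"
    using profile_coloring_in_colorings[of \<pi>] content_profile_coloring[of \<pi>]
    by (auto simp: partially_labeled_def)
next
  let ?n = "sum_list \<pi>"
  interpret group_action "sym_group ?n" "?S \<times> colorings ?n" "pair_action F ?n"
    by (rule group_action_pair_action)
  show "?orb ` (?S \<times> ?C) \<subseteq> partially_labeled F \<pi>"
  proof (rule image_subsetI)
    fix x assume "x \<in> ?S \<times> ?C"
    then obtain T c where x: "x = (T, c)" "T \<in> ?S" "c \<in> colorings ?n"
        "content ?n c = profile_monomial \<pi>" by auto
    then have "content ?n (profile_coloring \<pi>) = content ?n c"
      by (simp add: content_profile_coloring)
    then obtain \<sigma> where \<sigma>: "\<sigma> permutes {1..?n}"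
        "\<And>i. i \<in> {1..?n} \<Longrightarrow> profile_coloring \<pi> i = c (\<sigma> i)"
      by (rule content_eq_imp_permutes) blast
    \<comment> \<open>The action moves colors by the inverse, so the permutation carrying
      \<open>c\<close> to the profile coloring is the one with inverse
      \<open>\<sigma>\<close>.\<close>
    define \<tau> where "\<tau> = inv' \<sigma>"
    have \<tau>: "\<tau> permutes {1..?n}" "inv' \<tau> = \<sigma>"
      using \<sigma>(1) by (simp_all add: \<tau>_def permutes_inv permutes_inv_inv)
    let ?T = "transport F {1..?n} \<tau> T"
    have "(\<lambda>i\<in>{1..?n}. c (\<sigma> i)) = profile_coloring \<pi>"
      using \<sigma>(2) by (auto simp: fun_eq_iff profile_coloring_def)
    then have "pair_action F ?n \<tau> x = (?T, profile_coloring \<pi>)"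
      using x by (simp add: pair_action_def \<tau>)
    then have "(?T, profile_coloring \<pi>) \<in> ?orb x"
      using \<tau>(1) by (force simp: orbit_def sym_group_carrier)
    then have "?orb x = ?orb (?T, profile_coloring \<pi>)"
      using orbit_eq_of_mem[of x] x by simp
    moreover have "?T \<in> ?S" using pair_action_closed(1)[OF \<tau>(1)] x by simp
    ultimately show "?orb x \<in> partially_labeled F \<pi>"
      by (auto simp: partially_labeled_def)
  qed
qed

end

text \<open>Substituting \<open>\<sigma> i\<close> for \<open>i\<close> removes the inverse. This
  matches colorings fixed by the action with those counted by
  \<open>eta (p_perm n \<sigma>)\<close>.\<close>

lemma restrict_inv_eq_iff:
  assumes "\<sigma> permutes {1..n}" "c \<in> colorings n"
  shows "(\<lambda>i\<in>{1..n}. c (inv' \<sigma> i)) = c \<longleftrightarrow> (\<forall>i\<in>{1..n}. c (\<sigma> i) = c i)"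
proof -
  have "(\<lambda>i\<in>{1..n}. c (inv' \<sigma> i)) = c \<longleftrightarrow> (\<forall>i\<in>{1..n}. c (inv' \<sigma> i) = c i)"
    using assms(2) by (auto simp: colorings_def fun_eq_iff PiE_def extensional_def)
  also have "\<dots> \<longleftrightarrow> (\<forall>i\<in>\<sigma> ` {1..n}. c (inv' \<sigma> i) = c i)"
    using permutes_image[OF assms(1)] by simp
  also have "\<dots> \<longleftrightarrow> (\<forall>i\<in>{1..n}. c (\<sigma> i) = c i)"
    using permutes_inverses[OF assms(1)] by auto
  finally show ?thesis .
qed

section \<open>Counting the partially-labeled structures fixed by \<open>\<gamma>\<close>\<close>

context gamma_species
begin

text \<open>The twisted orbit count is applied to the finite invariant set of pairs with content
  \<open>profile_monomial \<pi>\<close>, inside the generally infinite set of all colored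
  structures.\<close>

lemma card_fixed_partially_labeled:
  assumes \<gamma>: "\<gamma> \<in> carrier G" and n: "n = sum_list \<pi>"
  shows "card {S \<in> partially_labeled F \<pi>. gact_pair F n \<gamma> ` S = S} * fact n =
    (\<Sum>\<sigma>\<in>carrier (sym_group n). fix_count F \<gamma> n \<sigma> *
      card {c \<in> colorings n. content n c = profile_monomial \<pi> \<and> (\<forall>i\<in>{1..n}. c (\<sigma> i) = c i)})"
proof -
  let ?S = "structures F {1..n}"
  let ?C = "{c \<in> colorings n. content n c = profile_monomial \<pi>}"
  interpret pa: group_action "sym_group n" "?S \<times> colorings n" "pair_action F n"
    by (rule group_action_pair_action)
  interpret ga: group_action G ?S "gact F {1..n}"
    by (rule gact_action) simp
  have eq: "partially_labeled F \<pi> = Group_Action.orbit (sym_group n) (pair_action F n) ` (?S \<times> ?C)"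
    unfolding n by (rule partially_labeled_eq_orbits)
  have bij: "bij_betw (gact_pair F n \<gamma>) (?S \<times> ?C) (?S \<times> ?C)"
  proof -
    have "bij_betw (gact F {1..n} \<gamma>) ?S ?S"
      using ga.surj_prop[OF \<gamma>] ga.inj_prop[OF \<gamma>] by (simp add: bij_betw_def)
    then have "bij_betw (map_prod (gact F {1..n} \<gamma>) id) (?S \<times> ?C) (?S \<times> ?C)"
      by (rule bij_betw_map_prod) simp
    moreover have "gact_pair F n \<gamma> = map_prod (gact F {1..n} \<gamma>) id"
      by (auto simp: gact_pair_def)
    ultimately show ?thesis by simp
  qed
  have "card {S \<in> partially_labeled F \<pi>. gact_pair F n \<gamma> ` S = S} * order (sym_group n) =
      (\<Sum>\<sigma>\<in>carrier (sym_group n). card {x \<in> ?S \<times> ?C. gact_pair F n \<gamma> (pair_action F n \<sigma> x) = x})"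
    unfolding eq
  proof (rule pa.twisted_burnside[OF _ _ _ _ bij])
    show "finite (carrier (sym_group n))"
      by (simp add: sym_group_def finite_permutations)
    show "finite (?S \<times> ?C)"
      using finite_structures finite_colorings_content by simp
    show "?S \<times> ?C \<subseteq> ?S \<times> colorings n" by auto
    fix \<sigma> x assume "\<sigma> \<in> carrier (sym_group n)" and x: "x \<in> ?S \<times> ?C"
    then have \<sigma>: "\<sigma> permutes {1..n}" by (simp add: sym_group_carrier)
    show "pair_action F n \<sigma> x \<in> ?S \<times> ?C"
      using x pair_action_closed[OF \<sigma>] content_permute[OF permutes_inv[OF \<sigma>]]
      by (auto simp: pair_action_def)
    show "gact_pair F n \<gamma> (pair_action F n \<sigma> x) = pair_action F n \<sigma> (gact_pair F n \<gamma> x)"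
      using x gact_transport[OF _ permutes_imp_bij[OF \<sigma>] \<gamma>] ga.element_image[OF \<gamma>]
      by (auto simp: pair_action_def gact_pair_def)
  qed
  also have "\<dots> = (\<Sum>\<sigma>\<in>carrier (sym_group n). fix_count F \<gamma> n \<sigma> *
      card {c \<in> colorings n. content n c = profile_monomial \<pi> \<and> (\<forall>i\<in>{1..n}. c (\<sigma> i) = c i)})"
  proof (rule sum.cong)
    fix \<sigma> assume "\<sigma> \<in> carrier (sym_group n)"
    then have \<sigma>: "\<sigma> permutes {1..n}" by (simp add: sym_group_carrier)
    \<comment> \<open>Structure and coloring move independently and \<open>\<gamma>\<close> leaves
      the coloring alone, so the fixed pairs form a product.\<close>
    have "{x \<in> ?S \<times> ?C. gact_pair F n \<gamma> (pair_action F n \<sigma> x) = x} =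
        {T \<in> ?S. gact F {1..n} \<gamma> (transport F {1..n} \<sigma> T) = T} \<times>
        {c \<in> colorings n. content n c = profile_monomial \<pi> \<and> (\<forall>i\<in>{1..n}. c (\<sigma> i) = c i)}"
      using restrict_inv_eq_iff[OF \<sigma>] by (auto simp: pair_action_def gact_pair_def)
    then show "card {x \<in> ?S \<times> ?C. gact_pair F n \<gamma> (pair_action F n \<sigma> x) = x} = fix_count F \<gamma> n \<sigma> *
      card {c \<in> colorings n. content n c = profile_monomial \<pi> \<and> (\<forall>i\<in>{1..n}. c (\<sigma> i) = c i)}"
      by (simp add: fix_count_def card_cartesian_product)
  qed simp
  also have "order (sym_group n) = fact n"
    by (simp add: order_def sym_group_card_carrier)
  finally show ?thesis .
qed

end

theorem theorem2p3:
  fixes G :: "('g, 'm) monoid_scheme"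
    and F :: "('g, 's, 'x) gspecies_scheme"
    and \<pi> :: "nat list"
    and n :: nat
    and \<gamma> :: 'g
  assumes "gamma_species G F"
    and "\<forall>p\<in>set \<pi>. 0 < p"
    and "sum_list \<pi> = n"
    and "\<gamma> \<in> carrier G"
  shows "of_nat (card {S \<in> partially_labeled F \<pi>. gact_pair F n \<gamma> ` S = S})
       = mfps_coeff (eta (cycle_index F \<gamma>)) (profile_monomial \<pi>)"
proof -
  interpret gamma_species G F by fact
  let ?N = "card {S \<in> partially_labeled F \<pi>. gact_pair F n \<gamma> ` S = S}"
  let ?c = "\<lambda>\<sigma>. card {c \<in> colorings n. content n c = profile_monomial \<pi> \<and> (\<forall>i\<in>{1..n}. c (\<sigma> i) = c i)}"
  have "mfps_coeff (eta (cycle_index F \<gamma>)) (profile_monomial \<pi>) =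
      mfps_coeff (eta (cycle_index_term F \<gamma> n)) (profile_monomial \<pi>)"
    using assms(3) by (simp only: mfps_coeff_eta_cycle_index mdeg_profile_monomial)
  also have "\<dots> = (\<Sum>\<sigma>\<in>carrier (sym_group n). of_nat (fix_count F \<gamma> n \<sigma>) * of_nat (?c \<sigma>)) / fact n"
    unfolding mfps_coeff_eta_cycle_index_term
    by (intro arg_cong[where f = "\<lambda>x. x / fact n"] sum.cong refl)
      (simp add: mfps_coeff_eta_p_perm sym_group_carrier)
  also have "\<dots> = of_nat (\<Sum>\<sigma>\<in>carrier (sym_group n). fix_count F \<gamma> n \<sigma> * ?c \<sigma>) / fact n"
    by simp
  \<comment> \<open>The group order in the orbit count cancels the normalization of the cycle
    index.\<close>
  also have "\<dots> = of_nat (?N * fact n) / fact n"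
    using card_fixed_partially_labeled[OF assms(4) assms(3)[symmetric]] by simp
  also have "\<dots> = of_nat ?N" by simp
  finally show ?thesis by simp
qed

end
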